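(* Let $\mathcal{X}=\{(Y_i,A_i,T_i)\}_{i=1}^n$ be the sample, with $Y_i\in\mathbb{R}$ the outcomes and $A_i,T_i\in\{0,1\}$ the treatment and period indicators. Let $\Omega$ be the (finite) set of admissible label permutations, equipped with the uniform probability $\mathcal{P}(\omega)=1/|\Omega|$. For $\omega\in\Omega$ let $\omega\mathcal{X}$ denote the sample obtained from $\mathcal{X}$ by relabelling the indicators $(A,T)$ according to $\omega$ and leaving the outcomes $Y$ unchanged. Let $D(\mathcal{X})$ be the real-valued test statistic and define the $p$-value $$p=\frac{1}{|\Omega|}\sum_{\omega\in\Omega}\mathbf{1}\{|D(\omega\mathcal{X})|\ge |D(\mathcal{X})|\}.$$ Under the sharp null of no treatment effect $H_0$ and the maintained exchangeability of the randomization mechanism (both as described in the context), the distribution of $\mathcal{X}$ is invariant under any $\omega\in\Omega$, i.e. $\omega\mathcal{X}$ has the same law as $\mathcal{X}$ for every $\omega\in\Omega$. Consequently, $$\mathbb{P}_{H_0}(p\le\alpha)\le\alpha\qquad\text{for all }\alpha\in[0,1];$$ that is, the test is finite-sample exact under these maintained conditions.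
   Context: Randomization-inference setting for Difference-in-Differences (DiD). The test statistic $D$ is the DiD estimate computed from outcomes $Y=(Y_1,\dots,Y_n)$ and labels $A=(A_1,\dots,A_n)$, $T=(T_1,\dots,T_n)$: the difference between the pre-to-post change in mean outcome among observations with $A_i=1$ and the corresponding change among observations with $A_i=0$ (post: $T_i=1$, pre: $T_i=0$). Each observation $i$ has potential outcomes $Y_i(0),Y_i(1)$ without and with treatment. Sharp null $H_0$: $Y_i(1)=Y_i(0)$ for all $i$. Under $H_0$ the observed outcomes are regarded as fixed, and only the labels $(A,T)$ vary. $\Omega$ is the set of admissible label permutations, meaning relabellings of the binary indicators (treatment and time) that are consistent with the design, i.e. that preserve the maintained null assignment mechanism. No further structure on $\Omega$ is assumed. Maintained exchangeability of the randomization mechanism: under $H_0$, the random assignment of the labels $(A,T)$ is distributionally unaffected by each relabelling $\omega\in\Omega$, i.e. $\omega(A,T)$ has the same law as $(A,T)$. This is a maintained randomization-inference condition, not a factual claim that calendar time is literally randomised. $\mathbb{P}_{H_0}$ denotes probability under $H_0$ and the maintained exchangeability condition. *)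

theory Defs
  imports "HOL-Probability.Probability"
begin

text \<open>
  Observations are indexed by a finite type, so that the sample size n is its cardinality.
  The indicators A and T have values in bool, True standing for 1.
\<close>

type_synonym 'i labels = "('i \<Rightarrow> bool) \<times> ('i \<Rightarrow> bool)"

type_synonym 'i sample = "('i \<Rightarrow> real) \<times> 'i labels"

definition sharp_null :: "('i \<Rightarrow> real) \<Rightarrow> ('i \<Rightarrow> real) \<Rightarrow> bool" where
  "sharp_null y0 y1 \<longleftrightarrow> (\<forall>i. y1 i = y0 i)"

text \<open>
  An observation is under treatment when it belongs to the treated group and to the post period.
  The potential outcomes are fixed numbers, so that randomness enters through the labels only.
\<close>

definition observed_outcome ::
  "('i \<Rightarrow> real) \<Rightarrow> ('i \<Rightarrow> real) \<Rightarrow> 'i labels \<Rightarrow> 'i \<Rightarrow> real" where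
  "observed_outcome y0 y1 = (\<lambda>(A, T) i. if A i \<and> T i then y1 i else y0 i)"

definition observed_sample ::
  "('i \<Rightarrow> real) \<Rightarrow> ('i \<Rightarrow> real) \<Rightarrow> 'i labels \<Rightarrow> 'i sample" where
  "observed_sample y0 y1 l = (observed_outcome y0 y1 l, l)"

text \<open>
  The mean of an empty cell is 0, as division by zero yields 0; the estimate is thus a total
  real-valued function of the sample.
\<close>

definition cell_mean :: "'i::finite sample \<Rightarrow> bool \<Rightarrow> bool \<Rightarrow> real" where
  "cell_mean = (\<lambda>(Y, A, T) a t.
     (\<Sum>i | A i = a \<and> T i = t. Y i) / real (card {i. A i = a \<and> T i = t}))"

definition did_estimate :: "'i::finite sample \<Rightarrow> real" where
  "did_estimate x =
     (cell_mean x True True - cell_mean x True False)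
     - (cell_mean x False True - cell_mean x False False)"

text \<open>
  A label permutation is a pair of permutations of the observations, the first one moving the
  treatment labels and the second one the time labels. Joint permutations of the pairs of labels
  are those with equal components; permutations of one kind of label only have an identity
  component.
\<close>

type_synonym 'i label_perm = "('i \<Rightarrow> 'i) \<times> ('i \<Rightarrow> 'i)"

definition relabel :: "'i label_perm \<Rightarrow> 'i labels \<Rightarrow> 'i labels" where
  "relabel = (\<lambda>(\<sigma>, \<tau>) (A, T). (A \<circ> \<sigma>, T \<circ> \<tau>))"

definition relabel_sample :: "'i label_perm \<Rightarrow> 'i sample \<Rightarrow> 'i sample" where
  "relabel_sample \<omega> = (\<lambda>(Y, l). (Y, relabel \<omega> l))"

text \<open>
  The design is given by the null assignment mechanism Q, a probability distribution on label
  assignments. The admissible label permutations are all those that preserve Q.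
\<close>

definition admissible :: "'i labels pmf \<Rightarrow> 'i label_perm set" where
  "admissible Q = {(\<sigma>, \<tau>). bij \<sigma> \<and> bij \<tau> \<and> map_pmf (relabel (\<sigma>, \<tau>)) Q = Q}"

text \<open>
  Exchangeability is stated for the law of the labels L under M, which is not required to be Q.
  If it is Q, the condition holds by definition of the admissible permutations.
\<close>

definition exchangeable ::
  "'w measure \<Rightarrow> ('w \<Rightarrow> 'i labels) \<Rightarrow> 'i label_perm set \<Rightarrow> bool" where
  "exchangeable M L \<Omega> \<longleftrightarrow>
     (\<forall>\<omega>\<in>\<Omega>. distr M (count_space UNIV) (\<lambda>s. relabel \<omega> (L s)) = distr M (count_space UNIV) L)"

definition p_value :: "'i::finite label_perm set \<Rightarrow> 'i sample \<Rightarrow> real" where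
  "p_value \<Omega> x = 1 / real (card \<Omega>) *
     (\<Sum>\<omega>\<in>\<Omega>. of_bool (\<bar>did_estimate (relabel_sample \<omega> x)\<bar> \<ge> \<bar>did_estimate x\<bar>))"

definition sample_measure :: "'i sample measure" where
  "sample_measure = (\<Pi>\<^sub>M i\<in>UNIV. borel) \<Otimes>\<^sub>M count_space UNIV"

end

theory Submission imports Defs begin

text \<open>
  The admissible relabellings are finitely many and closed under composition, so composing with a
  fixed one permutes them. The p-value of a relabelled sample is therefore its upper rank
  among the statistics of all relabellings of the original sample, divided by their number. In any
  finite family at most a fraction \<alpha> of the members has relative rank at most \<alpha>. By
  invariance, the probability in question is the expectation of this fraction.
\<close>

text \<open>Among the members of upper rank at most c, take one, m, with the least value of f. All
  these members lie in the upper set of m, which has at most c elements by the choice of m. Ties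
  only enlarge upper sets, so they do no harm.\<close>

lemma card_upper_rank_le:
  fixes f :: "'a \<Rightarrow> 'b::linorder" and c :: real
  assumes "finite S" "0 \<le> c"
  shows "real (card {g \<in> S. real (card {h \<in> S. f g \<le> f h}) \<le> c}) \<le> c"
proof (cases "{g \<in> S. real (card {h \<in> S. f g \<le> f h}) \<le> c} = {}")
  \<comment> \<open>Without such a member there is no minimum to take; the bound is then 0 \<le>
    c.\<close>
  case True
  show ?thesis unfolding True using assms by simp
next
  case False
  let ?R = "{g \<in> S. real (card {h \<in> S. f g \<le> f h}) \<le> c}"
  have fin: "finite ?R" using assms by simp
  then obtain m where m: "m \<in> ?R" "\<And>g. g \<in> ?R \<Longrightarrow> f m \<le> f g"
    using ex_min_if_finite[of "f ` ?R"] False by (force simp: not_less)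
  have "card ?R \<le> card {h \<in> S. f m \<le> f h}"
    using assms m by (intro card_mono) auto
  then show ?thesis using m(1) by auto
qed

text \<open>Double counting: the expected number of g in G with \<open>P (f g x)\<close> is
  \<open>card G * q\<close> by linearity, and at most \<open>a * card G\<close> because the number
  obeys this bound at every point.\<close>

lemma (in prob_space) prob_le_of_invariant:
  assumes "finite G" "G \<noteq> {}"
    and meas: "\<And>g. g \<in> G \<Longrightarrow> {x \<in> space M. P (f g x)} \<in> events"
    and inv: "\<And>g. g \<in> G \<Longrightarrow> prob {x \<in> space M. P (f g x)} = q"
    and bound: "\<And>x. x \<in> space M \<Longrightarrow> real (card {g \<in> G. P (f g x)}) \<le> a * real (card G)"
  shows "q \<le> a"
proof -
  let ?E = "\<lambda>g. {x \<in> space M. P (f g x)}"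
  have "real (card G) * q = (\<Sum>g\<in>G. prob (?E g))"
    using inv by simp
  also have "\<dots> = (\<Sum>g\<in>G. expectation (indicator (?E g)))"
    using meas by (intro sum.cong) auto
  also have "\<dots> = expectation (\<lambda>x. \<Sum>g\<in>G. indicator (?E g) x)"
    using meas by (subst Bochner_Integration.integral_sum)
      (auto intro!: integrable_real_indicator simp: less_top[symmetric])
  also have "\<dots> \<le> a * real (card G)"
  proof (intro integral_le_const AE_I2)
    show "integrable M (\<lambda>x. \<Sum>g\<in>G. indicator (?E g) x :: real)"
      using meas by (auto intro!: Bochner_Integration.integrable_sum integrable_real_indicator
          simp: less_top[symmetric])
    fix x assume x: "x \<in> space M"
    have "(\<Sum>g\<in>G. indicator (?E g) x :: real) = real (card {g \<in> G. P (f g x)})"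
      using x assms(1) by (simp add: indicator_def of_bool_def flip: sum.inter_filter)
    then show "(\<Sum>g\<in>G. indicator (?E g) x) \<le> a * real (card G)"
      using bound[OF x] by simp
  qed
  finally show ?thesis
    using assms(1,2) by (simp add: mult.commute card_gt_0_iff)
qed

text \<open>Labels are precomposed with permutations, so relabelling is a right action: in
  \<open>perm_comp \<omega> \<omega>'\<close> the relabelling by \<omega> comes first.\<close>

definition perm_comp :: "'i label_perm \<Rightarrow> 'i label_perm \<Rightarrow> 'i label_perm" where
  "perm_comp \<omega> \<omega>' = (fst \<omega> \<circ> fst \<omega>', snd \<omega> \<circ> snd \<omega>')"

lemma relabel_perm_comp: "relabel (perm_comp \<omega> \<omega>') l = relabel \<omega>' (relabel \<omega> l)"
  by (simp add: relabel_def perm_comp_def case_prod_beta comp_assoc)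

lemma relabel_sample_perm_comp:
  "relabel_sample (perm_comp \<omega> \<omega>') x = relabel_sample \<omega>' (relabel_sample \<omega> x)"
  by (simp add: relabel_sample_def case_prod_beta relabel_perm_comp)

lemma admissible_iff:
  "\<omega> \<in> admissible Q \<longleftrightarrow> bij (fst \<omega>) \<and> bij (snd \<omega>) \<and> map_pmf (relabel \<omega>) Q = Q"
  by (simp add: admissible_def case_prod_beta)

lemma id_admissible: "(id, id) \<in> admissible Q"
  by (simp add: admissible_iff relabel_def case_prod_beta map_pmf_ident)

lemma perm_comp_admissible:
  assumes "\<omega> \<in> admissible Q" "\<omega>' \<in> admissible Q"
  shows "perm_comp \<omega> \<omega>' \<in> admissible Q"
proof -
  have "map_pmf (relabel (perm_comp \<omega> \<omega>')) Q = map_pmf (relabel \<omega>') (map_pmf (relabel \<omega>) Q)"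
    by (simp add: map_pmf_comp relabel_perm_comp[abs_def])
  then show ?thesis
    using assms by (simp add: admissible_iff perm_comp_def bij_comp)
qed

text \<open>A bijection cancels on the left, so composing with \<omega> is injective; an injective
  self-map of a finite set is onto. This takes the place of an argument with inverses.\<close>

lemma bij_betw_perm_comp:
  fixes Q :: "'i::finite labels pmf"
  assumes "\<omega> \<in> admissible Q"
  shows "bij_betw (perm_comp \<omega>) (admissible Q) (admissible Q)"
proof -
  have inj: "inj (fst \<omega>)" "inj (snd \<omega>)"
    using assms by (auto simp: admissible_iff bij_is_inj)
  have "inj_on (perm_comp \<omega>) (admissible Q)"
    using inj by (intro inj_onI) (simp add: perm_comp_def prod_eq_iff fun_eq_iff inj_eq)
  moreover have "perm_comp \<omega> ` admissible Q \<subseteq> admissible Q"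
    using assms by (auto intro: perm_comp_admissible)
  ultimately show ?thesis
    by (simp add: bij_betw_def endo_inj_surj)
qed

lemma p_value_eq_card:
  fixes \<Omega> :: "'i::finite label_perm set"
  shows "p_value \<Omega> x = real (card {\<omega> \<in> \<Omega>. \<bar>did_estimate x\<bar> \<le> \<bar>did_estimate (relabel_sample \<omega> x)\<bar>})
    / real (card \<Omega>)"
  by (simp add: p_value_def of_bool_def flip: sum.inter_filter)

text \<open>Relabelling the sample moves the observed statistic, but the reference family stays that
  of x: \<open>perm_comp \<omega>\<close> merely reindexes it.\<close>

lemma p_value_relabel_sample:
  fixes Q :: "'i::finite labels pmf"
  assumes "\<omega> \<in> admissible Q"
  shows "p_value (admissible Q) (relabel_sample \<omega> x) =
    real (card {\<omega>' \<in> admissible Q.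
      \<bar>did_estimate (relabel_sample \<omega> x)\<bar> \<le> \<bar>did_estimate (relabel_sample \<omega>' x)\<bar>})
    / real (card (admissible Q))"
  unfolding p_value_eq_card
proof (intro arg_cong2[where f = "(/)"] arg_cong[where f = real] refl bij_betw_same_card)
  show "bij_betw (perm_comp \<omega>)
    {\<omega>' \<in> admissible Q. \<bar>did_estimate (relabel_sample \<omega> x)\<bar>
       \<le> \<bar>did_estimate (relabel_sample \<omega>' (relabel_sample \<omega> x))\<bar>}
    {\<omega>' \<in> admissible Q. \<bar>did_estimate (relabel_sample \<omega> x)\<bar>
       \<le> \<bar>did_estimate (relabel_sample \<omega>' x)\<bar>}"
    using bij_betw_perm_comp[OF assms]
    by (rule bij_betw_Collect) (simp add: relabel_sample_perm_comp)
qed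

text \<open>The rank bound with c = \<alpha> times the number of admissible relabellings.\<close>

lemma card_p_value_le:
  fixes Q :: "'i::finite labels pmf"
  assumes "0 \<le> \<alpha>"
  shows "real (card {\<omega> \<in> admissible Q. p_value (admissible Q) (relabel_sample \<omega> x) \<le> \<alpha>})
    \<le> \<alpha> * real (card (admissible Q))"
proof -
  let ?D = "\<lambda>\<omega>. \<bar>did_estimate (relabel_sample \<omega> x)\<bar>"
  \<comment> \<open>Positivity allows the denominator of the p-value to be cleared.\<close>
  have "card (admissible Q) > 0"
    using id_admissible by (auto simp: card_gt_0_iff)
  then have "{\<omega> \<in> admissible Q. p_value (admissible Q) (relabel_sample \<omega> x) \<le> \<alpha>} =
    {\<omega> \<in> admissible Q. real (card {\<omega>' \<in> admissible Q. ?D \<omega> \<le> ?D \<omega>'})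
      \<le> \<alpha> * real (card (admissible Q))}"
    by (auto simp: p_value_relabel_sample divide_le_eq)
  then show ?thesis
    using assms card_upper_rank_le[of "admissible Q" "\<alpha> * real (card (admissible Q))" ?D] by simp
qed

text \<open>Here the null fixes the outcomes: both potential outcomes agree, so the labels no longer
  influence which value is observed.\<close>

lemma observed_sample_sharp_null:
  assumes "sharp_null y0 y1"
  shows "observed_sample y0 y1 l = (y0, l)"
  using assms
  by (auto simp: observed_sample_def observed_outcome_def sharp_null_def case_prod_beta fun_eq_iff)

theorem theorem1:
  fixes M :: "'w measure"
    and A T :: "'w \<Rightarrow> 'i::finite \<Rightarrow> bool"
    and y0 y1 :: "'i \<Rightarrow> real"
    and Q :: "'i labels pmf"
  defines "L \<equiv> \<lambda>s. (A s, T s)"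
  defines "X \<equiv> \<lambda>s. observed_sample y0 y1 (L s)"
  defines "\<Omega> \<equiv> admissible Q"
  assumes "prob_space M"
    and "L \<in> M \<rightarrow>\<^sub>M count_space UNIV"
    and "sharp_null y0 y1"
    and "exchangeable M L \<Omega>"
  shows "(\<forall>\<omega>\<in>\<Omega>. distr M sample_measure (\<lambda>s. relabel_sample \<omega> (X s)) = distr M sample_measure X) \<and>
    (\<forall>\<alpha>\<in>{0..1::real}. measure M {s \<in> space M. p_value \<Omega> (X s) \<le> \<alpha>} \<le> \<alpha>)"
proof -
  interpret prob_space M by fact
  note L[measurable] = \<open>L \<in> M \<rightarrow>\<^sub>M count_space UNIV\<close>
  have X: "X = (\<lambda>s. (y0, L s))"
    using \<open>sharp_null y0 y1\<close> by (simp add: X_def fun_eq_iff observed_sample_sharp_null)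
  have relabel_X: "relabel_sample \<omega> (X s) = (y0, relabel \<omega> (L s))" for \<omega> s
    by (simp add: X relabel_sample_def)
  have meas_relabel: "(\<lambda>s. relabel \<omega> (L s)) \<in> M \<rightarrow>\<^sub>M count_space UNIV" for \<omega>
    by measurable
  have exch: "distr M (count_space UNIV) (\<lambda>s. relabel \<omega> (L s)) = distr M (count_space UNIV) L"
    if "\<omega> \<in> \<Omega>" for \<omega>
    using \<open>exchangeable M L \<Omega>\<close> that by (simp add: exchangeable_def)
  \<comment> \<open>With outcomes fixed at y0, the law of a sample is the image of the law of its
    labels under \<open>Pair y0\<close>. Measurability of this map lets equality of label laws carry
    over to samples.\<close>
  have "y0 \<in> space (\<Pi>\<^sub>M i\<in>UNIV. borel)"
    by (simp add: space_PiM)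
  then have pair: "Pair y0 \<in> count_space UNIV \<rightarrow>\<^sub>M sample_measure"
    unfolding sample_measure_def by measurable
  have "distr M sample_measure (\<lambda>s. relabel_sample \<omega> (X s)) = distr M sample_measure X"
    if "\<omega> \<in> \<Omega>" for \<omega>
    using distr_distr[OF pair meas_relabel, of \<omega>] distr_distr[OF pair L] exch[OF that]
    unfolding relabel_X by (simp add: comp_def X)
  moreover have "prob {s \<in> space M. p_value \<Omega> (X s) \<le> \<alpha>} \<le> \<alpha>" if "\<alpha> \<in> {0..1}" for \<alpha>
  proof (rule prob_le_of_invariant[where G = \<Omega> and P = "\<lambda>x. p_value \<Omega> x \<le> \<alpha>"
        and f = "\<lambda>\<omega> s. relabel_sample \<omega> (X s)"])
    \<comment> \<open>The rejection event depends on the labels alone. Every set of labels is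
      measurable in the discrete \<sigma>-algebra, so exchangeability of L gives this event the same
      probability after each relabelling.\<close>
    let ?S = "{l. p_value \<Omega> (y0, l) \<le> \<alpha>}"
    have eq: "{s \<in> space M. p_value \<Omega> (relabel_sample \<omega> (X s)) \<le> \<alpha>} =
        (\<lambda>s. relabel \<omega> (L s)) -` ?S \<inter> space M" for \<omega>
      by (auto simp: relabel_X)
    show "finite \<Omega>" "\<Omega> \<noteq> {}"
      using id_admissible by (auto simp: \<Omega>_def)
    show "{s \<in> space M. p_value \<Omega> (relabel_sample \<omega> (X s)) \<le> \<alpha>} \<in> events" for \<omega>
      unfolding eq using meas_relabel by (rule measurable_sets) simp
    have "prob ((\<lambda>s. relabel \<omega> (L s)) -` ?S \<inter> space M) = prob (L -` ?S \<inter> space M)"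
      if "\<omega> \<in> \<Omega>" for \<omega>
      using measure_distr[OF meas_relabel[of \<omega>], of ?S] measure_distr[OF L, of ?S] exch[OF that] by simp
    moreover have "L -` ?S \<inter> space M = {s \<in> space M. p_value \<Omega> (X s) \<le> \<alpha>}"
      by (auto simp: X)
    ultimately show "prob {s \<in> space M. p_value \<Omega> (relabel_sample \<omega> (X s)) \<le> \<alpha>} =
        prob {s \<in> space M. p_value \<Omega> (X s) \<le> \<alpha>}" if "\<omega> \<in> \<Omega>" for \<omega>
      unfolding eq using that by simp
    \<comment> \<open>For a fixed outcome s this is the purely combinatorial rank bound.\<close>
    show "real (card {\<omega> \<in> \<Omega>. p_value \<Omega> (relabel_sample \<omega> (X s)) \<le> \<alpha>}) \<le> \<alpha> * real (card \<Omega>)"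
      for s
      using \<open>\<alpha> \<in> {0..1}\<close> by (simp add: \<Omega>_def card_p_value_le)
  qed
  ultimately show ?thesis by blast
qed

end
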